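(* The suffix points $\mathcal S(L_W)$ of the Lawvere Laplacian $L_W$ form a weighted lattice, i.e. the $\mathsf Q$-category $\mathcal S(L_W)$ admits all weighted meets and joins.
   Context: Throughout, $\mathsf Q=(Q,\preceq,\cdot,1)$ is a commutative, unital, semicartesian quantale: $(Q,\preceq)$ is a complete lattice, $\cdot$ is an associative commutative operation with unit $1$ that distributes over arbitrary joins in each variable, and $p\cdot q\preceq p\wedge q$ (so $1=\top$). $[p,q]:=\bigvee\{r: p\cdot r\preceq q\}$. A (small) $\mathsf Q$-category $\mathsf C$ is a set $\mathrm{ob}(\mathsf C)$ with elements $\hom_{\mathsf C}(x,y)\in Q$ such that $\hom_{\mathsf C}(x,x)=1$ and $\hom_{\mathsf C}(x,y)\cdot\hom_{\mathsf C}(y,z)\preceq\hom_{\mathsf C}(x,z)$. A $\mathsf Q$-functor is a function $F$ on objects with $\hom_{\mathsf C}(x,y)\preceq\hom_{\mathsf D}(Fx,Fy)$. $x\preceq_q y$ means $\hom(x,y)\succeq q$; $x\approx_q y$ means $x\preceq_q y$ and $y\preceq_q x$. Given a set $\mathsf S$, $S:\mathsf S\to\mathrm{ob}(\mathsf C)$ and $W:\mathsf S\to Q$, the weighted meet $\bigwedge^W S$ is an object (unique up to $\approx_1$) with $\hom_{\mathsf C}(x,\bigwedge^W S)=\bigwedge_{c\in\mathsf S}[W(c),\hom_{\mathsf C}(x,S(c))]$ for all $x$; the weighted join $\bigvee^W S$ is an object with $\hom_{\mathsf C}(\bigvee^W S,x)=\bigwedge_{c}[W(c),\hom_{\mathsf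 C}(S(c),x)]$ for all $x$. A $\mathsf Q$-category is a (complete) weighted lattice if it has all weighted meets and joins. $G=(V,E)$ is a simple undirected graph; $\partial e$ is the set of endpoints of $e$; $N_v$ is the set of neighbors of $v$; $v\triangleleft e$ means $v\in\partial e$. $\underline F$ is a network sheaf and $\overline F$ a network cosheaf of complete weighted lattices agreeing on objects: for each $\sigma\in V\sqcup E$ a complete weighted lattice $F\sigma$, and for each $v\triangleleft e$ (arbitrary) $\mathsf Q$-functors $\underline F_{v\triangleleft e}:Fv\to Fe$ and $\overline F_{e\triangleright v}:Fe\to Fv$. $C^0F=\prod_{v\in V}Fv$ with $\hom_{C^0F}(\vec x,\vec y)=\bigwedge_v\hom_{Fv}(x_v,y_v)$. $W:V\times V\to Q$ is a weighting. The Lawvere Laplacian $L_W:\mathrm{ob}(C^0F)\to\mathrm{ob}(C^0F)$ is $$(L_W\vec x)_v=\bigwedge^{W(v,-)}_{w\in N_v,\ \partial e=\{v,w\}}\overline F_{e\triangleright v}\underline F_{w\triangleleft e}x_w$$ (with any choice of representatives of the weighted meets). $\mathcal S(L_W)$ is the full $\mathsf Q$-subcategory of $C^0F$ on the objects $\vec x$ with $\vec x\preceq_1 L_W\vec x$. *)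

theory Defs
  imports Main "HOL-Library.FuncSet"
begin

section \<open>Quantales\<close>

text \<open>Distributivity in the first variable follows from commutativity of \<open>*\<close>.\<close>

class comm_semicartesian_quantale = complete_lattice + comm_monoid_mult +
  assumes mult_Sup: "p * Sup A = (SUP q\<in>A. p * q)"
    and mult_le_inf: "p * q \<le> inf p q"

definition qhom :: "'q::comm_semicartesian_quantale \<Rightarrow> 'q \<Rightarrow> 'q" where
  "qhom p q = Sup {r. p * r \<le> q}"


section \<open>Categories enriched in a quantale\<close>

record ('a, 'q) qcat =
  ob :: "'a set"
  hom :: "'a \<Rightarrow> 'a \<Rightarrow> 'q"

definition is_qcat :: "('a, 'q::comm_semicartesian_quantale) qcat \<Rightarrow> bool" where
  "is_qcat C \<longleftrightarrow>
     (\<forall>x\<in>ob C. hom C x x = 1) \<and>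
     (\<forall>x\<in>ob C. \<forall>y\<in>ob C. \<forall>z\<in>ob C. hom C x y * hom C y z \<le> hom C x z)"

definition is_qfunctor ::
    "('a, 'q::comm_semicartesian_quantale) qcat \<Rightarrow> ('b, 'q) qcat \<Rightarrow> ('a \<Rightarrow> 'b) \<Rightarrow> bool" where
  "is_qfunctor C D F \<longleftrightarrow>
     F \<in> ob C \<rightarrow> ob D \<and>
     (\<forall>x\<in>ob C. \<forall>y\<in>ob C. hom C x y \<le> hom D (F x) (F y))"

definition qle :: "('a, 'q::comm_semicartesian_quantale) qcat \<Rightarrow> 'q \<Rightarrow> 'a \<Rightarrow> 'a \<Rightarrow> bool" where
  "qle C q x y \<longleftrightarrow> q \<le> hom C x y"

definition full_subcat :: "('a, 'q) qcat \<Rightarrow> 'a set \<Rightarrow> ('a, 'q) qcat" where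
  "full_subcat C A = \<lparr>ob = A, hom = hom C\<rparr>"

definition is_weighted_meet ::
    "('a, 'q::comm_semicartesian_quantale) qcat \<Rightarrow> 'i set \<Rightarrow> ('i \<Rightarrow> 'q) \<Rightarrow> ('i \<Rightarrow> 'a) \<Rightarrow> 'a \<Rightarrow> bool" where
  "is_weighted_meet C I W S m \<longleftrightarrow>
     m \<in> ob C \<and> (\<forall>x\<in>ob C. hom C x m = (INF i\<in>I. qhom (W i) (hom C x (S i))))"

definition is_weighted_join ::
    "('a, 'q::comm_semicartesian_quantale) qcat \<Rightarrow> 'i set \<Rightarrow> ('i \<Rightarrow> 'q) \<Rightarrow> ('i \<Rightarrow> 'a) \<Rightarrow> 'a \<Rightarrow> bool" where
  "is_weighted_join C I W S j \<longleftrightarrow>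
     j \<in> ob C \<and> (\<forall>x\<in>ob C. hom C j x = (INF i\<in>I. qhom (W i) (hom C (S i) x)))"

text \<open>
  A definition cannot quantify over all index sets of all types, so the type \<open>'i\<close> in which the
  index sets live is a parameter. Taking for \<open>'i\<close> the type of the objects is the strongest
  choice: by \<open>weighted_lattice_any_index\<close> below it yields the meets and joins of families
  indexed by sets of any other type.
\<close>

definition weighted_lattice ::
    "'i itself \<Rightarrow> ('a, 'q::comm_semicartesian_quantale) qcat \<Rightarrow> bool" where
  "weighted_lattice T C \<longleftrightarrow>
     is_qcat C \<and>
     (\<forall>(I :: 'i set) W S. S \<in> I \<rightarrow> ob C \<longrightarrow>
        (\<exists>m. is_weighted_meet C I W S m) \<and> (\<exists>j. is_weighted_join C I W S j))"

lemma mult_mono_right: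
  fixes p :: "'q::comm_semicartesian_quantale"
  assumes "q \<le> r" shows "p * q \<le> p * r"
proof -
  have "p * r = p * Sup {q, r}" using assms by (simp add: sup_absorb2)
  also have "\<dots> = sup (p * q) (p * r)" by (subst mult_Sup) simp
  finally show ?thesis by (metis sup_ge1)
qed

lemma le_qhom_iff:
  fixes p :: "'q::comm_semicartesian_quantale"
  shows "r \<le> qhom p q \<longleftrightarrow> p * r \<le> q"
proof
  assume "r \<le> qhom p q"
  then have "p * r \<le> p * qhom p q" by (rule mult_mono_right)
  also have "\<dots> \<le> q" unfolding qhom_def mult_Sup by (auto intro: SUP_least)
  finally show "p * r \<le> q" .
next
  assume "p * r \<le> q"
  then show "r \<le> qhom p q" unfolding qhom_def by (auto intro: Sup_upper)
qed

lemma INF_qhom_reindex: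
  fixes W :: "'i \<Rightarrow> 'q::comm_semicartesian_quantale"
  shows "(INF c\<in>S ` I. qhom (SUP i\<in>{i\<in>I. S i = c}. W i) (f c)) = (INF i\<in>I. qhom (W i) (f (S i)))"
proof -
  have "r \<le> (INF c\<in>S ` I. qhom (SUP i\<in>{i\<in>I. S i = c}. W i) (f c))
      \<longleftrightarrow> r \<le> (INF i\<in>I. qhom (W i) (f (S i)))" for r
  proof -
    have "(SUP i\<in>A. W i) * r = (SUP i\<in>A. W i * r)" for A
      using mult_Sup[of r "W ` A"] by (simp add: image_comp comp_def mult.commute[of r])
    then have "(SUP i\<in>{i\<in>I. S i = c}. W i) * r \<le> f c \<longleftrightarrow> (\<forall>i\<in>I. S i = c \<longrightarrow> W i * r \<le> f c)" for c
      by (simp add: SUP_le_iff Ball_def imp_conjL)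
    then show ?thesis by (simp add: le_INF_iff le_qhom_iff) metis
  qed
  from this[THEN iffD1, OF order_refl] this[THEN iffD2, OF order_refl] show ?thesis
    by (rule order_antisym)
qed

lemma weighted_lattice_any_index:
  fixes C :: "('a, 'q::comm_semicartesian_quantale) qcat"
  assumes "weighted_lattice TYPE('a) C"
  shows "weighted_lattice TYPE('i) C"
  unfolding weighted_lattice_def
proof (intro conjI allI impI)
  show "is_qcat C" using assms by (simp add: weighted_lattice_def)
  fix I :: "'i set" and W S
  assume "S \<in> I \<rightarrow> ob C"
  then have "id \<in> S ` I \<rightarrow> ob C" by auto
  with assms have "(\<exists>m. is_weighted_meet C (S ` I) (\<lambda>c. SUP i\<in>{i\<in>I. S i = c}. W i) id m) \<and>
    (\<exists>j. is_weighted_join C (S ` I) (\<lambda>c. SUP i\<in>{i\<in>I. S i = c}. W i) id j)"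
    unfolding weighted_lattice_def by blast
  then show "\<exists>m. is_weighted_meet C I W S m" "\<exists>j. is_weighted_join C I W S j"
    unfolding is_weighted_meet_def is_weighted_join_def id_def INF_qhom_reindex by auto
qed


section \<open>Network sheaves and cosheaves\<close>

definition simple_graph :: "'v set \<Rightarrow> 'v set set \<Rightarrow> bool" where
  "simple_graph V E \<longleftrightarrow> (\<forall>e\<in>E. e \<subseteq> V \<and> card e = 2)"

definition neighbors :: "'v set set \<Rightarrow> 'v \<Rightarrow> 'v set" where
  "neighbors E v = {w. {v, w} \<in> E}"

text \<open>
  An edge is its own set of endpoints. \<open>FV\<close> and \<open>FE\<close> are the stalks over vertices and edges;
  a sheaf and a cosheaf agree on objects when they share them. \<open>R v e\<close> is the map from the
  stalk at \<open>v\<close> to the one at \<open>e\<close>, and \<open>X e v\<close> is the map in the opposite direction.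
\<close>

definition weighted_lattice_stalks ::
    "'v set \<Rightarrow> 'v set set \<Rightarrow> ('v \<Rightarrow> ('a, 'q::comm_semicartesian_quantale) qcat) \<Rightarrow>
     ('v set \<Rightarrow> ('b, 'q) qcat) \<Rightarrow> bool" where
  "weighted_lattice_stalks V E FV FE \<longleftrightarrow>
     (\<forall>v\<in>V. weighted_lattice TYPE('a) (FV v)) \<and>
     (\<forall>e\<in>E. weighted_lattice TYPE('b) (FE e))"

definition network_sheaf ::
    "'v set \<Rightarrow> 'v set set \<Rightarrow> ('v \<Rightarrow> ('a, 'q::comm_semicartesian_quantale) qcat) \<Rightarrow>
     ('v set \<Rightarrow> ('b, 'q) qcat) \<Rightarrow> ('v \<Rightarrow> 'v set \<Rightarrow> 'a \<Rightarrow> 'b) \<Rightarrow> bool" where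
  "network_sheaf V E FV FE R \<longleftrightarrow>
     weighted_lattice_stalks V E FV FE \<and>
     (\<forall>e\<in>E. \<forall>v\<in>e. is_qfunctor (FV v) (FE e) (R v e))"

definition network_cosheaf ::
    "'v set \<Rightarrow> 'v set set \<Rightarrow> ('v \<Rightarrow> ('a, 'q::comm_semicartesian_quantale) qcat) \<Rightarrow>
     ('v set \<Rightarrow> ('b, 'q) qcat) \<Rightarrow> ('v set \<Rightarrow> 'v \<Rightarrow> 'b \<Rightarrow> 'a) \<Rightarrow> bool" where
  "network_cosheaf V E FV FE X \<longleftrightarrow>
     weighted_lattice_stalks V E FV FE \<and>
     (\<forall>e\<in>E. \<forall>v\<in>e. is_qfunctor (FE e) (FV v) (X e v))"

definition cochains0 ::
    "'v set \<Rightarrow> ('v \<Rightarrow> ('a, 'q::comm_semicartesian_quantale) qcat) \<Rightarrow> ('v \<Rightarrow> 'a, 'q) qcat" where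
  "cochains0 V FV =
     \<lparr>ob = (\<Pi>\<^sub>E v\<in>V. ob (FV v)), hom = (\<lambda>x y. INF v\<in>V. hom (FV v) (x v) (y v))\<rparr>"

text \<open>
  Weighted meets are unique only up to isomorphism, so being a Lawvere Laplacian is a predicate,
  satisfied by the maps arising from every choice of representatives.
\<close>

definition is_lawvere_laplacian ::
    "'v set \<Rightarrow> 'v set set \<Rightarrow> ('v \<Rightarrow> ('a, 'q::comm_semicartesian_quantale) qcat) \<Rightarrow>
     ('v \<Rightarrow> 'v set \<Rightarrow> 'a \<Rightarrow> 'b) \<Rightarrow> ('v set \<Rightarrow> 'v \<Rightarrow> 'b \<Rightarrow> 'a) \<Rightarrow> ('v \<Rightarrow> 'v \<Rightarrow> 'q) \<Rightarrow>
     (('v \<Rightarrow> 'a) \<Rightarrow> ('v \<Rightarrow> 'a)) \<Rightarrow> bool" where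
  "is_lawvere_laplacian V E FV R X W L \<longleftrightarrow>
     L \<in> ob (cochains0 V FV) \<rightarrow> ob (cochains0 V FV) \<and>
     (\<forall>x\<in>ob (cochains0 V FV). \<forall>v\<in>V.
        is_weighted_meet (FV v) (neighbors E v) (W v)
          (\<lambda>w. X {v, w} v (R w {v, w} (x w))) (L x v))"

lemma lawvere_laplacian_exists:
  fixes FV :: "'v \<Rightarrow> ('a, 'q::comm_semicartesian_quantale) qcat"
    and FE :: "'v set \<Rightarrow> ('b, 'q) qcat"
  assumes "simple_graph V E" "network_sheaf V E FV FE R" "network_cosheaf V E FV FE X"
  shows "\<exists>L. is_lawvere_laplacian V E FV R X W L"
proof -
  let ?M = "\<lambda>x v m. is_weighted_meet (FV v) (neighbors E v) (W v)
                      (\<lambda>w. X {v, w} v (R w {v, w} (x w))) m"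
  have ex: "\<exists>m. ?M x v m" if x: "x \<in> ob (cochains0 V FV)" and v: "v \<in> V" for x v
  proof -
    have "X {v, w} v (R w {v, w} (x w)) \<in> ob (FV v)" if "w \<in> neighbors E v" for w
    proof -
      have e: "{v, w} \<in> E" using that by (simp add: neighbors_def)
      then have "w \<in> V" using assms(1) by (auto simp: simple_graph_def)
      then have "x w \<in> ob (FV w)" using x by (auto simp: cochains0_def)
      moreover have "R w {v, w} \<in> ob (FV w) \<rightarrow> ob (FE {v, w})" "X {v, w} v \<in> ob (FE {v, w}) \<rightarrow> ob (FV v)"
        using e assms(2,3) by (simp_all add: network_sheaf_def network_cosheaf_def is_qfunctor_def)
      ultimately show ?thesis by (blast dest: funcset_mem)
    qed
    moreover have "weighted_lattice TYPE('v) (FV v)"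
      by (rule weighted_lattice_any_index) (use assms(2) v in
            \<open>simp add: network_sheaf_def weighted_lattice_stalks_def\<close>)
    ultimately show ?thesis by (simp add: weighted_lattice_def Pi_iff)
  qed
  define L where "L = (\<lambda>x. \<lambda>v\<in>V. SOME m. ?M x v m)"
  have M: "?M x v (L x v)" if "x \<in> ob (cochains0 V FV)" "v \<in> V" for x v
    using someI_ex[OF ex[OF that]] that(2) by (simp add: L_def)
  then have "L x v \<in> ob (FV v)" if "x \<in> ob (cochains0 V FV)" "v \<in> V" for x v
    using that by (simp add: is_weighted_meet_def)
  then have "L \<in> ob (cochains0 V FV) \<rightarrow> ob (cochains0 V FV)"
    by (simp add: Pi_iff cochains0_def PiE_iff) (simp add: L_def)
  with M show ?thesis by (auto simp: is_lawvere_laplacian_def)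
qed

definition suffix_points ::
    "('a, 'q::comm_semicartesian_quantale) qcat \<Rightarrow> ('a \<Rightarrow> 'a) \<Rightarrow> ('a, 'q) qcat" where
  "suffix_points C L = full_subcat C {x \<in> ob C. qle C 1 x (L x)}"

end

(*
  In the presence of arbitrary weighted joins, a weighted meet is the join of all objects x, each
  weighted by the value that hom(x, meet) ought to have. So only joins are needed: they are computed
  pointwise on cochains, and they restrict to the suffix points of any Q-functor, among which the
  Laplacian is one.
*)
theory Submission
  imports Defs
begin

lemma one_eq_top: "(1::'q::comm_semicartesian_quantale) = top"
  using mult_le_inf[of top "1::'q"] by (simp add: top.extremum_unique)

lemma mult_mono_quantale:
  fixes p q r s :: "'q::comm_semicartesian_quantale"
  assumes "p \<le> q" "r \<le> s" shows "p * r \<le> q * s"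
  by (metis assms mult.commute mult_mono_right order_trans)

text \<open>By \<open>le_qhom_iff\<close>, \<open>qhom p\<close> is right adjoint to multiplication
  by \<open>p\<close>, and right adjoints preserve infima.\<close>

lemma qhom_INF:
  fixes p :: "'q::comm_semicartesian_quantale"
  shows "qhom p (INF i\<in>I. f i) = (INF i\<in>I. qhom p (f i))"
proof -
  have "r \<le> qhom p (INF i\<in>I. f i) \<longleftrightarrow> r \<le> (INF i\<in>I. qhom p (f i))" for r
    by (simp add: le_qhom_iff le_INF_iff)
  then show ?thesis by (metis order_antisym order_refl)
qed

lemma hom_refl: "is_qcat C \<Longrightarrow> x \<in> ob C \<Longrightarrow> hom C x x = 1"
  by (simp add: is_qcat_def)

lemma hom_trans:
  assumes "is_qcat C" "x \<in> ob C" "y \<in> ob C" "z \<in> ob C" "p \<le> hom C x y" "q \<le> hom C y z"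
  shows "p * q \<le> hom C x z"
proof -
  have "p * q \<le> hom C x y * hom C y z" using assms(5,6) by (rule mult_mono_quantale)
  also have "\<dots> \<le> hom C x z" using assms(1-4) by (simp add: is_qcat_def)
  finally show ?thesis .
qed

text \<open>Testing the universal property at \<open>j\<close> itself, where the hom is 1, shows
  that a weighted join is a cocone over its family. The next lemma is the dual.\<close>

lemma weighted_join_cocone:
  assumes "is_qcat C" "is_weighted_join C I W S j" "i \<in> I"
  shows "W i \<le> hom C (S i) j"
proof -
  have "1 = (INF i\<in>I. qhom (W i) (hom C (S i) j))"
    using assms(2) hom_refl[OF assms(1), of j] by (simp add: is_weighted_join_def)
  also have "\<dots> \<le> qhom (W i) (hom C (S i) j)" using assms(3) by (rule INF_lower)
  finally show ?thesis by (simp add: le_qhom_iff)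
qed

lemma weighted_meet_cone:
  assumes "is_qcat C" "is_weighted_meet C I W S m" "i \<in> I"
  shows "W i \<le> hom C m (S i)"
proof -
  have "1 = (INF i\<in>I. qhom (W i) (hom C m (S i)))"
    using assms(2) hom_refl[OF assms(1), of m] by (simp add: is_weighted_meet_def)
  also have "\<dots> \<le> qhom (W i) (hom C m (S i))" using assms(3) by (rule INF_lower)
  finally show ?thesis by (simp add: le_qhom_iff)
qed

lemma weighted_meet_from_join:
  assumes C: "is_qcat C" and S: "S \<in> I \<rightarrow> ob C"
    and m: "is_weighted_join C (ob C) (\<lambda>x. INF i\<in>I. qhom (W i) (hom C x (S i))) id m"
  shows "is_weighted_meet C I W S m"
proof -
  let ?M = "\<lambda>x. INF i\<in>I. qhom (W i) (hom C x (S i))"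
  have mob: "m \<in> ob C"
    and hom_m: "\<And>x. x \<in> ob C \<Longrightarrow> hom C m x = (INF y\<in>ob C. qhom (?M y) (hom C y x))"
    using m by (simp_all add: is_weighted_join_def)
  \<comment> \<open>By definition of \<open>?M\<close>, \<open>W i\<close> lies below every term of
    the infimum that computes \<open>hom C m (S i)\<close>; hence \<open>m\<close> is a cone over
    \<open>S\<close>, which bounds \<open>hom C x m\<close> by \<open>?M x\<close>.\<close>
  have "W i \<le> hom C m (S i)" if i: "i \<in> I" for i
  proof -
    have "?M y * W i \<le> hom C y (S i)" for y
    proof -
      have "?M y \<le> qhom (W i) (hom C y (S i))" using i by (rule INF_lower)
      then show ?thesis by (simp add: le_qhom_iff mult.commute)
    qed
    moreover have "S i \<in> ob C" using i S by auto
    ultimately show ?thesis by (subst hom_m) (auto simp: le_qhom_iff intro: INF_greatest)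
  qed
  then have "W i * hom C x m \<le> hom C x (S i)" if "x \<in> ob C" "i \<in> I" for x i
    using hom_trans[OF C that(1) mob, of "S i" "hom C x m" "W i"] that S
    by (simp add: mult.commute Pi_iff)
  then have "hom C x m \<le> ?M x" if "x \<in> ob C" for x
    using that by (simp add: le_INF_iff le_qhom_iff)
  \<comment> \<open>The object \<open>x\<close> itself occurs in the join with weight
    \<open>?M x\<close>, so the cocone inequality is the reverse bound.\<close>
  moreover have "?M x \<le> hom C x m" if "x \<in> ob C" for x
    using weighted_join_cocone[OF C m that] by simp
  ultimately show ?thesis using mob by (simp add: is_weighted_meet_def order_antisym)
qed

text \<open>The join that produces a meet is indexed by \<open>ob C\<close>, so joins over sets in
  the type of objects suffice; \<open>weighted_lattice_any_index\<close> then passes to any index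
  type.\<close>

lemma weighted_lattice_if_joins:
  fixes C :: "('a, 'q::comm_semicartesian_quantale) qcat"
  assumes C: "is_qcat C"
    and joins: "\<And>(I :: 'a set) W S. S \<in> I \<rightarrow> ob C \<Longrightarrow> \<exists>j. is_weighted_join C I W S j"
  shows "weighted_lattice TYPE('i) C"
proof -
  have "\<exists>m. is_weighted_meet C I W S m" if "S \<in> I \<rightarrow> ob C" for I :: "'a set" and W S
    using joins[of id "ob C"] weighted_meet_from_join[OF C that] by fastforce
  then have "weighted_lattice TYPE('a) C"
    using C joins by (simp add: weighted_lattice_def)
  then show ?thesis by (rule weighted_lattice_any_index)
qed

text \<open>Enriched form of the fact that a supremum of suffix points of a monotone map is a suffix
  point: \<open>L\<close> preserves the degrees \<open>W i\<close> of the cocone \<open>j\<close>,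
  and \<open>S i\<close> lies below \<open>L (S i)\<close>, so \<open>L j\<close> is a cocone over
  \<open>S\<close> too. The universal property of \<open>j\<close>, tested at \<open>L j\<close>,
  puts \<open>j\<close> below \<open>L j\<close>.\<close>

lemma weighted_lattice_suffix_points:
  fixes C :: "('a, 'q::comm_semicartesian_quantale) qcat"
  assumes C: "is_qcat C" and L: "is_qfunctor C C L"
    and joins: "\<And>(I :: 'a set) W S. S \<in> I \<rightarrow> ob C \<Longrightarrow> \<exists>j. is_weighted_join C I W S j"
  shows "weighted_lattice TYPE('i) (suffix_points C L)"
proof (rule weighted_lattice_if_joins)
  show "is_qcat (suffix_points C L)"
    using C by (auto simp: is_qcat_def suffix_points_def full_subcat_def)
next
  fix I :: "'a set" and W S
  assume S: "S \<in> I \<rightarrow> ob (suffix_points C L)"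
  then have Sob: "S i \<in> ob C" and SL: "1 \<le> hom C (S i) (L (S i))" if "i \<in> I" for i
    using that by (auto simp: suffix_points_def full_subcat_def qle_def)
  have Lob: "L x \<in> ob C" if "x \<in> ob C" for x
    using L that by (auto simp: is_qfunctor_def)
  obtain j where j: "is_weighted_join C I W S j" using joins[of S I] Sob by blast
  then have job: "j \<in> ob C" by (simp add: is_weighted_join_def)
  have "W i \<le> hom C (S i) (L j)" if i: "i \<in> I" for i
  proof -
    have "W i \<le> hom C (S i) j" using C j i by (rule weighted_join_cocone)
    also have "\<dots> \<le> hom C (L (S i)) (L j)" using L Sob[OF i] job by (simp add: is_qfunctor_def)
    finally show ?thesis
      using hom_trans[OF C Sob[OF i] Lob[OF Sob[OF i]] Lob[OF job] SL[OF i]] by simp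
  qed
  then have "1 \<le> hom C j (L j)"
    using j Lob[OF job] by (simp add: is_weighted_join_def le_INF_iff le_qhom_iff)
  \<comment> \<open>The subcategory is full, so \<open>j\<close> keeps its universal property, now
    against fewer test objects.\<close>
  then show "\<exists>j. is_weighted_join (suffix_points C L) I W S j"
    using j by (auto simp: is_weighted_join_def suffix_points_def full_subcat_def qle_def)
qed

lemma cochains0_is_qcat:
  assumes "\<And>v. v \<in> V \<Longrightarrow> is_qcat (FV v)"
  shows "is_qcat (cochains0 V FV)"
proof -
  have "(INF v\<in>V. hom (FV v) (x v) (y v)) * (INF v\<in>V. hom (FV v) (y v) (z v))
      \<le> (INF v\<in>V. hom (FV v) (x v) (z v))"
    if "x \<in> (\<Pi>\<^sub>E v\<in>V. ob (FV v))" "y \<in> (\<Pi>\<^sub>E v\<in>V. ob (FV v))" "z \<in> (\<Pi>\<^sub>E v\<in>V. ob (FV v))" for x y z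
  proof (rule INF_greatest)
    fix v assume v: "v \<in> V"
    show "(INF v\<in>V. hom (FV v) (x v) (y v)) * (INF v\<in>V. hom (FV v) (y v) (z v))
        \<le> hom (FV v) (x v) (z v)"
      by (rule hom_trans[OF assms[OF v], of _ "y v"])
        (use v that in \<open>auto simp: PiE_iff intro: INF_lower\<close>)
  qed
  \<comment> \<open>Since 1 is \<open>top\<close>, this holds for empty \<open>V\<close> as
    well.\<close>
  moreover have "(INF v\<in>V. hom (FV v) (x v) (x v)) = 1" if "x \<in> (\<Pi>\<^sub>E v\<in>V. ob (FV v))" for x
    using assms that by (auto simp: hom_refl one_eq_top PiE_iff intro!: INF_eqI)
  ultimately show ?thesis by (simp add: is_qcat_def cochains0_def)
qed

text \<open>The weights do not depend on \<open>v\<close>, so the infima over \<open>V\<close> and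
  \<open>I\<close> can be exchanged and the one over \<open>V\<close> pulled inside
  \<open>qhom (W i)\<close>. Extensionality makes \<open>j\<close> an element of the
  product.\<close>

lemma cochains0_weighted_join_pointwise:
  assumes "j \<in> extensional V"
    and "\<And>v. v \<in> V \<Longrightarrow> is_weighted_join (FV v) I W (\<lambda>i. S i v) (j v)"
  shows "is_weighted_join (cochains0 V FV) I W S j"
proof -
  have "(INF v\<in>V. hom (FV v) (j v) (x v)) = (INF i\<in>I. qhom (W i) (INF v\<in>V. hom (FV v) (S i v) (x v)))"
    if "x \<in> (\<Pi>\<^sub>E v\<in>V. ob (FV v))" for x
  proof -
    have "(INF v\<in>V. hom (FV v) (j v) (x v)) = (INF v\<in>V. INF i\<in>I. qhom (W i) (hom (FV v) (S i v) (x v)))"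
      using assms(2) that by (intro INF_cong) (auto simp: is_weighted_join_def)
    also have "\<dots> = (INF i\<in>I. INF v\<in>V. qhom (W i) (hom (FV v) (S i v) (x v)))"
      by (rule INF_commute)
    finally show ?thesis by (simp add: qhom_INF)
  qed
  moreover have "j \<in> (\<Pi>\<^sub>E v\<in>V. ob (FV v))"
    using assms by (auto simp: PiE_iff is_weighted_join_def)
  ultimately show ?thesis by (simp add: is_weighted_join_def cochains0_def)
qed

lemma cochains0_weighted_join_exists:
  fixes FV :: "'v \<Rightarrow> ('a, 'q::comm_semicartesian_quantale) qcat" and I :: "'i set"
  assumes "\<And>v. v \<in> V \<Longrightarrow> weighted_lattice TYPE('a) (FV v)"
    and S: "S \<in> I \<rightarrow> ob (cochains0 V FV)"
  shows "\<exists>j. is_weighted_join (cochains0 V FV) I W S j"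
proof -
  have "\<exists>j. is_weighted_join (FV v) I W (\<lambda>i. S i v) j" if v: "v \<in> V" for v
  proof -
    \<comment> \<open>The stalks are given with index sets in their own object type, while the
      family is indexed in \<open>'i\<close>.\<close>
    have "weighted_lattice TYPE('i) (FV v)" using assms(1)[OF v] by (rule weighted_lattice_any_index)
    moreover have "(\<lambda>i. S i v) \<in> I \<rightarrow> ob (FV v)" using S v by (auto simp: cochains0_def)
    ultimately show ?thesis by (auto simp: weighted_lattice_def)
  qed
  then obtain j where "\<And>v. v \<in> V \<Longrightarrow> is_weighted_join (FV v) I W (\<lambda>i. S i v) (j v)" by metis
  then have "is_weighted_join (cochains0 V FV) I W S (restrict j V)"
    by (intro cochains0_weighted_join_pointwise) auto
  then show ?thesis by blast
qed

text \<open>Enriched monotonicity of meets: each composite \<open>?G v w\<close> of a sheaf and a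
  cosheaf map preserves the degree \<open>hom ?C x y\<close>, so \<open>L x v\<close> is a cone over
  the family of \<open>y\<close> with weights \<open>W v w * hom ?C x y\<close>. The universal
  property of \<open>L y v\<close> turns this into the bound on the hom.\<close>

lemma lawvere_laplacian_is_qfunctor:
  assumes graph: "simple_graph V E"
    and sheaf: "network_sheaf V E FV FE R"
    and cosheaf: "network_cosheaf V E FV FE X"
    and L: "is_lawvere_laplacian V E FV R X W L"
  shows "is_qfunctor (cochains0 V FV) (cochains0 V FV) L"
proof -
  let ?C = "cochains0 V FV"
  let ?G = "\<lambda>v w a. X {v, w} v (R w {v, w} a)"
  have meet: "is_weighted_meet (FV v) (neighbors E v) (W v) (\<lambda>w. ?G v w (x w)) (L x v)"
    if "x \<in> ob ?C" "v \<in> V" for x v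
    using L that by (simp add: is_lawvere_laplacian_def)
  have "hom ?C x y \<le> hom (FV v) (L x v) (L y v)" if x: "x \<in> ob ?C" and y: "y \<in> ob ?C" and v: "v \<in> V" for x y v
  proof -
    have qcat: "is_qcat (FV v)"
      using sheaf v by (simp add: network_sheaf_def weighted_lattice_stalks_def weighted_lattice_def)
    have Lx: "L x v \<in> ob (FV v)" using meet[OF x v] by (simp add: is_weighted_meet_def)
    have "W v w * hom ?C x y \<le> hom (FV v) (L x v) (?G v w (y w))" if w: "w \<in> neighbors E v" for w
    proof -
      have e: "{v, w} \<in> E" using w by (simp add: neighbors_def)
      then have wV: "w \<in> V" using graph by (auto simp: simple_graph_def)
      then have xw: "x w \<in> ob (FV w)" and yw: "y w \<in> ob (FV w)"
        using x y by (auto simp: cochains0_def)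
      have R: "is_qfunctor (FV w) (FE {v, w}) (R w {v, w})"
        and X: "is_qfunctor (FE {v, w}) (FV v) (X {v, w} v)"
        using e sheaf cosheaf by (simp_all add: network_sheaf_def network_cosheaf_def)
      have Rx: "R w {v, w} (x w) \<in> ob (FE {v, w})" and Ry: "R w {v, w} (y w) \<in> ob (FE {v, w})"
        using R xw yw by (auto simp: is_qfunctor_def)
      have G: "?G v w (x w) \<in> ob (FV v)" "?G v w (y w) \<in> ob (FV v)"
        using X Rx Ry by (auto simp: is_qfunctor_def)
      have "hom ?C x y \<le> hom (FV w) (x w) (y w)"
        using INF_lower[OF wV] by (simp add: cochains0_def)
      also have "\<dots> \<le> hom (FE {v, w}) (R w {v, w} (x w)) (R w {v, w} (y w))"
        using R xw yw by (simp add: is_qfunctor_def)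
      also have "\<dots> \<le> hom (FV v) (?G v w (x w)) (?G v w (y w))"
        using X Rx Ry by (simp add: is_qfunctor_def)
      \<comment> \<open>Compose the cone of the meet \<open>L x v\<close> with the degree just
        carried through \<open>?G v w\<close>.\<close>
      finally show ?thesis
        using hom_trans[OF qcat Lx G] weighted_meet_cone[OF qcat meet[OF x v] w] by blast
    qed
    then show ?thesis
      using meet[OF y v] Lx by (simp add: is_weighted_meet_def le_INF_iff le_qhom_iff)
  qed
  then have "hom ?C x y \<le> hom ?C (L x) (L y)" if "x \<in> ob ?C" "y \<in> ob ?C" for x y
    using that by (simp add: cochains0_def le_INF_iff)
  then show ?thesis using L by (simp add: is_qfunctor_def is_lawvere_laplacian_def)
qed

theorem corollary3p19:
  fixes V :: "'v set" and E :: "'v set set"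
    and FV :: "'v \<Rightarrow> ('a, 'q::comm_semicartesian_quantale) qcat"
    and FE :: "'v set \<Rightarrow> ('b, 'q) qcat"
    and R :: "'v \<Rightarrow> 'v set \<Rightarrow> 'a \<Rightarrow> 'b"
    and X :: "'v set \<Rightarrow> 'v \<Rightarrow> 'b \<Rightarrow> 'a"
    and W :: "'v \<Rightarrow> 'v \<Rightarrow> 'q"
    and L :: "('v \<Rightarrow> 'a) \<Rightarrow> ('v \<Rightarrow> 'a)"
  assumes "simple_graph V E"
    and "network_sheaf V E FV FE R"
    and "network_cosheaf V E FV FE X"
    and "is_lawvere_laplacian V E FV R X W L"
  shows "weighted_lattice TYPE('i) (suffix_points (cochains0 V FV) L)"
proof (rule weighted_lattice_suffix_points)
  have stalks: "weighted_lattice TYPE('a) (FV v)" if "v \<in> V" for v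
    using assms(2) that by (simp add: network_sheaf_def weighted_lattice_stalks_def)
  then show "is_qcat (cochains0 V FV)"
    by (intro cochains0_is_qcat) (auto simp: weighted_lattice_def)
  show "is_qfunctor (cochains0 V FV) (cochains0 V FV) L"
    using assms by (rule lawvere_laplacian_is_qfunctor)
  show "\<exists>j. is_weighted_join (cochains0 V FV) I U S j"
    if "S \<in> I \<rightarrow> ob (cochains0 V FV)" for I :: "('v \<Rightarrow> 'a) set" and U S
    using stalks that by (rule cochains0_weighted_join_exists)
qed

end
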